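(* Let $A$ be a finite set, let $E$ be a set of equivalence relations on $A$, $\Gamma$ a set of permutations of $A$, and $\Sigma$ a set of nonempty subsets of $A$. The clone $\mathrm{Pol}(E,\Gamma,\Sigma)$ is a member of $\mathfrak{F}_A$ if and only if both of the following hold: (a) $E$ is a chain (i.e., any two members of $E$ are comparable with respect to inclusion), and (b) $\Gamma\subseteq\mathrm{Pol}\,E$ (i.e., every $\gamma\in\Gamma$, regarded as a unary operation, preserves every equivalence relation in $E$).
   Context: $A$ is a finite nonempty set. For $n\ge 1$, an $n$-ary operation on $A$ is a function $A^n\to A$; $\mathcal{O}_A$ is the set of all finitary operations on $A$, and for $\mathcal{C}\subseteq\mathcal{O}_A$, $\mathcal{C}^{(n)}$ is the set of $n$-ary members of $\mathcal{C}$. A clone on $A$ is a set $\mathcal{C}\subseteq\mathcal{O}_A$ containing all projections and closed under composition: $g(f_1,\dots,f_m)\in\mathcal{C}^{(n)}$ whenever $g\in\mathcal{C}^{(m)}$ and $f_1,\dots,f_m\in\mathcal{C}^{(n)}$. For a clone $\mathcal{C}$, an $n$-ary operation $f$ and an $m$-ary operation $g$ on $A$, write $f\leq_{\mathcal{C}} g$ if $f=g(h_1,\dots,h_m)$ for some $h_1,\dots,h_m\in\mathcal{C}^{(n)}$, and $f\equiv_{\mathcal{C}}g$ if $f\leq_{\mathcal{C}}g$ and $g\leq_{\mathcal{C}}f$; $\equiv_{\mathcal{C}}$ is an equivalence relation on $\mathcal{O}_A$. $\mathfrak{F}_A$ denotes the set of all clones $\mathcal{C}$ on $A$ such that $\equiv_{\mathcal{C}}$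 has only finitely many equivalence classes on $\mathcal{O}_A$. An operation preserves an $r$-ary relation $\rho\subseteq A^r$ if applying it coordinatewise to tuples from $\rho$ always gives a tuple in $\rho$. A subset of $A$ is treated as a unary relation, and a permutation $\gamma$ of $A$ is treated as the binary relation $\{(a,\gamma(a)):a\in A\}$ (so $f$ preserves $\gamma$ iff $f(\gamma(a_1),\dots,\gamma(a_n))=\gamma(f(a_1,\dots,a_n))$ for all $a_i\in A$). $\mathrm{Pol}(E,\Gamma,\Sigma)$ is the clone of all operations on $A$ preserving every member of $E$, of $\Gamma$ and of $\Sigma$; $\mathrm{Pol}\,E$ is the clone of all operations preserving every member of $E$. *)

theory Defs
  imports Main "HOL-Library.FuncSet" "HOL-Combinatorics.Permutations"
begin

definition tuples :: "'a set \<Rightarrow> nat \<Rightarrow> 'a list set" where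
  "tuples A n = {xs. length xs = n \<and> set xs \<subseteq> A}"

text \<open>An operation carries its arity. Its function part is extensional, so that two operations
  on \<open>A\<close> are equal iff they have the same arity and agree on all tuples over \<open>A\<close>.\<close>

type_synonym 'a operation = "nat \<times> ('a list \<Rightarrow> 'a)"

definition operations :: "'a set \<Rightarrow> 'a operation set" where
  "operations A = {(n, f). n \<ge> 1 \<and> f \<in> tuples A n \<rightarrow>\<^sub>E A}"

definition projection :: "'a set \<Rightarrow> nat \<Rightarrow> nat \<Rightarrow> 'a operation" where
  "projection A n i = (n, \<lambda>xs\<in>tuples A n. xs ! i)"

definition compose_op :: "'a set \<Rightarrow> nat \<Rightarrow> ('a list \<Rightarrow> 'a) \<Rightarrow> ('a list \<Rightarrow> 'a) list \<Rightarrow> 'a operation" where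
  "compose_op A n g fs = (n, \<lambda>xs\<in>tuples A n. g (map (\<lambda>f. f xs) fs))"

definition clone :: "'a set \<Rightarrow> 'a operation set \<Rightarrow> bool" where
  "clone A C \<longleftrightarrow>
     C \<subseteq> operations A \<and>
     (\<forall>n i. i < n \<longrightarrow> projection A n i \<in> C) \<and>
     (\<forall>m n g fs. (m, g) \<in> C \<longrightarrow> length fs = m \<longrightarrow> (\<forall>f\<in>set fs. (n, f) \<in> C)
        \<longrightarrow> compose_op A n g fs \<in> C)"

definition clone_le :: "'a set \<Rightarrow> 'a operation set \<Rightarrow> 'a operation \<Rightarrow> 'a operation \<Rightarrow> bool" where
  "clone_le A C F G \<longleftrightarrow>
     (\<exists>hs. length hs = fst G \<and> (\<forall>h\<in>set hs. (fst F, h) \<in> C)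
        \<and> F = compose_op A (fst F) (snd G) hs)"

definition clone_equiv :: "'a set \<Rightarrow> 'a operation set \<Rightarrow> 'a operation rel" where
  "clone_equiv A C =
     {(F, G). F \<in> operations A \<and> G \<in> operations A \<and> clone_le A C F G \<and> clone_le A C G F}"

definition finite_class_clones :: "'a set \<Rightarrow> 'a operation set set" ("\<FF>") where
  "\<FF> A = {C. clone A C \<and> finite (operations A // clone_equiv A C)}"

text \<open>A finitary relation is a pair of its arity and a set of tuples of that length.\<close>

type_synonym 'a relation = "nat \<times> 'a list set"

definition preserves :: "'a operation \<Rightarrow> 'a relation \<Rightarrow> bool" where
  "preserves F R \<longleftrightarrow>
     (\<forall>ts. length ts = fst F \<longrightarrow> set ts \<subseteq> snd R \<longrightarrow>
        map (\<lambda>i. snd F (map (\<lambda>t. t ! i) ts)) [0..<fst R] \<in> snd R)"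

definition Pol :: "'a set \<Rightarrow> 'a relation set \<Rightarrow> 'a operation set" where
  "Pol A Rs = {F \<in> operations A. \<forall>R\<in>Rs. preserves F R}"

definition binary_relation :: "'a rel \<Rightarrow> 'a relation" where
  "binary_relation \<theta> = (2, {[a, b] | a b. (a, b) \<in> \<theta>})"

definition graph_relation :: "'a set \<Rightarrow> ('a \<Rightarrow> 'a) \<Rightarrow> 'a relation" where
  "graph_relation A \<gamma> = binary_relation {(a, \<gamma> a) | a. a \<in> A}"

definition unary_relation :: "'a set \<Rightarrow> 'a relation" where
  "unary_relation S = (1, {[a] | a. a \<in> S})"

definition unary_operation :: "'a set \<Rightarrow> ('a \<Rightarrow> 'a) \<Rightarrow> 'a operation" where
  "unary_operation A \<gamma> = (1, \<lambda>xs\<in>tuples A 1. \<gamma> (xs ! 0))"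

end

theory Submission imports Defs begin

text \<open>An inequality \<open>f \<le> g\<close> modulo a clone of polymorphisms is a homomorphism between powers of
  the relational structure on \<open>A\<close> that respects the colourings \<open>f\<close> and \<open>g\<close>.

  If two equivalence relations \<open>\<alpha>\<close> and \<open>\<beta>\<close> of \<open>E\<close> are incomparable, some power of \<open>A\<close> can be
  3-coloured so that walks alternating both between \<open>\<alpha>\<close> and \<open>\<beta>\<close> and between two of the colours
  have any prescribed maximal length. This length is monotone in the operation, so there are
  infinitely many classes. If \<open>\<gamma>\<close> does not preserve \<open>\<theta>\<close>, then \<open>\<theta>\<close> and \<open>\<gamma>(\<theta>)\<close> are both preserved
  by the clone, and they are incomparable because they have the same number of pairs.

  Conversely, it suffices to treat the polymorphisms of the chain \<open>E\<close>, all its automorphisms and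
  all subsets of \<open>A\<close>. The blocks of the chain turn a coloured power of \<open>A\<close> into a leaf-coloured
  tree of bounded depth with an action of the automorphism group. Going up the chain, one assigns
  to every block one of finitely many types such that blocks of equal type are related by
  partial homomorphisms in both directions.\<close>

section \<open>Polymorphisms\<close>

lemma tuples_iff: "xs \<in> tuples A n \<longleftrightarrow> length xs = n \<and> set xs \<subseteq> A"
  by (simp add: tuples_def)

lemma listrel_tuples:
  assumes "\<theta> \<subseteq> A \<times> A" "(x, y) \<in> listrel \<theta>" "length x = n \<or> length y = n"
  shows "x \<in> tuples A n" "y \<in> tuples A n"
proof -
  have "x \<in> lists A" "y \<in> lists A" using listrel_subset[OF assms(1)] assms(2) by auto
  then show "x \<in> tuples A n" "y \<in> tuples A n"
    using assms(2,3) by (auto simp: tuples_iff listrel_iff_nth)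
qed

text \<open>Transposing \<open>n\<close> pairs picked from \<theta> gives two
  \<open>n\<close>-tuples related coordinatewise, so preservation can be handled through
  \<open>listrel\<close> from here on.\<close>

lemma preserves_binary_iff:
  "preserves (n, f) (binary_relation \<theta>) \<longleftrightarrow>
     (\<forall>xs ys. length xs = n \<longrightarrow> (xs, ys) \<in> listrel \<theta> \<longrightarrow> (f xs, f ys) \<in> \<theta>)"
    (is "?L \<longleftrightarrow> ?R")
proof
  assume L: ?L
  show ?R
  proof (intro allI impI)
    fix xs ys assume n: "length xs = n" and xy: "(xs, ys) \<in> listrel \<theta>"
    have len: "length xs = length ys" and nth: "\<And>i. i < n \<Longrightarrow> (xs ! i, ys ! i) \<in> \<theta>"
      using xy n by (auto simp: listrel_iff_nth)
    define ts where "ts = map (\<lambda>i. [xs ! i, ys ! i]) [0..<n]"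
    have "length ts = n" "set ts \<subseteq> {[a, b] |a b. (a, b) \<in> \<theta>}"
      using nth by (auto simp: ts_def)
    then have "map (\<lambda>i. f (map (\<lambda>t. t ! i) ts)) [0..<2] \<in> {[a, b] |a b. (a, b) \<in> \<theta>}"
      using L by (simp add: preserves_def binary_relation_def)
    moreover have "map (\<lambda>t. t ! 0) ts = xs" "map (\<lambda>t. t ! 1) ts = ys"
      using n len by (auto simp: ts_def intro!: nth_equalityI)
    ultimately show "(f xs, f ys) \<in> \<theta>"
      by (simp add: numeral_2_eq_2)
  qed
next
  assume R: ?R
  show ?L
    unfolding preserves_def binary_relation_def fst_conv snd_conv
  proof (intro allI impI)
    fix ts assume ts: "length ts = n" "set ts \<subseteq> {[a, b] |a b. (a, b) \<in> \<theta>}"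
    have "(ts ! i ! 0, ts ! i ! 1) \<in> \<theta>" if "i < n" for i
      using ts nth_mem[of i ts] that by fastforce
    then have "(map (\<lambda>t. t ! 0) ts, map (\<lambda>t. t ! 1) ts) \<in> listrel \<theta>"
      using ts by (auto simp: listrel_iff_nth)
    then have "(f (map (\<lambda>t. t ! 0) ts), f (map (\<lambda>t. t ! 1) ts)) \<in> \<theta>"
      using R ts(1) by simp
    then show "map (\<lambda>i. f (map (\<lambda>t. t ! i) ts)) [0..<2] \<in> {[a, b] |a b. (a, b) \<in> \<theta>}"
      by (simp add: numeral_2_eq_2)
  qed
qed

text \<open>\<open>graph_relation\<close> contains only pairs whose first entry lies in
  \<open>A\<close>; the typing of \<open>f\<close> supplies this membership and leaves the bare
  commutation law.\<close>

lemma preserves_graph_iff: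
  assumes "f \<in> tuples A n \<rightarrow>\<^sub>E A"
  shows "preserves (n, f) (graph_relation A \<gamma>) \<longleftrightarrow>
     (\<forall>xs\<in>tuples A n. f (map \<gamma> xs) = \<gamma> (f xs))"
proof -
  have "(xs, ys) \<in> listrel {(a, \<gamma> a) |a. a \<in> A} \<longleftrightarrow> set xs \<subseteq> A \<and> ys = map \<gamma> xs" for xs ys
    by (auto simp: listrel_iff_nth in_set_conv_nth intro!: nth_equalityI
        intro: subsetD[OF _ nth_mem])
  then have "preserves (n, f) (graph_relation A \<gamma>) \<longleftrightarrow>
      (\<forall>xs\<in>tuples A n. \<exists>a\<in>A. f xs = a \<and> f (map \<gamma> xs) = \<gamma> a)"
    unfolding graph_relation_def preserves_binary_iff by (auto simp: tuples_iff)
  moreover have "f xs \<in> A" if "xs \<in> tuples A n" for xs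
    using assms that by (rule PiE_mem)
  ultimately show ?thesis by auto
qed

lemma preserves_unary_iff:
  "preserves (n, f) (unary_relation S) \<longleftrightarrow> (\<forall>xs\<in>tuples S n. f xs \<in> S)"
    (is "?L \<longleftrightarrow> ?R")
proof
  assume L: ?L
  show ?R
  proof
    fix xs assume xs: "xs \<in> tuples S n"
    have "map (\<lambda>i. f (map (\<lambda>t. t ! i) (map (\<lambda>a. [a]) xs))) [0..<1] \<in> {[a] |a. a \<in> S}"
      using L xs unfolding preserves_def unary_relation_def fst_conv snd_conv
      by (elim allE[of _ "map (\<lambda>a. [a]) xs"]) (auto simp: tuples_iff)
    then show "f xs \<in> S" by (simp add: comp_def)
  qed
next
  assume R: ?R
  show ?L
    unfolding preserves_def unary_relation_def fst_conv snd_conv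
  proof (intro allI impI)
    fix ts assume ts: "length ts = n" "set ts \<subseteq> {[a] |a. a \<in> S}"
    then have "map (\<lambda>t. t ! 0) ts \<in> tuples S n" by (auto simp: tuples_iff)
    then show "map (\<lambda>i. f (map (\<lambda>t. t ! i) ts)) [0..<1] \<in> {[a] |a. a \<in> S}"
      using R by simp
  qed
qed

lemma clone_Pol:
  assumes "\<And>R t. R \<in> Rs \<Longrightarrow> t \<in> snd R \<Longrightarrow> t \<in> tuples A (fst R)"
  shows "clone A (Pol A Rs)"
  unfolding clone_def
proof (intro conjI allI impI)
  show "Pol A Rs \<subseteq> operations A" by (auto simp: Pol_def)
next
  fix n i :: nat assume i: "i < n"
  have "preserves (projection A n i) R" if R: "R \<in> Rs" for R
    unfolding preserves_def
  proof (intro allI impI)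
    fix ts assume ts: "length ts = fst (projection A n i)" "set ts \<subseteq> snd R"
    have n: "length ts = n" using ts by (simp add: projection_def)
    have mem: "ts ! i \<in> snd R" using n i ts(2) by auto
    have col: "map (\<lambda>t. t ! j) ts \<in> tuples A n" if "j < fst R" for j
      using assms[OF R] ts(2) n that by (fastforce simp: tuples_iff)
    have "map (\<lambda>j. snd (projection A n i) (map (\<lambda>t. t ! j) ts)) [0..<fst R] = ts ! i"
      using assms[OF R mem] col n i
      by (auto simp: projection_def tuples_iff intro!: nth_equalityI)
    then show "map (\<lambda>j. snd (projection A n i) (map (\<lambda>t. t ! j) ts)) [0..<fst R] \<in> snd R"
      using mem by simp
  qed
  moreover have "projection A n i \<in> operations A"
    using i by (auto simp: projection_def operations_def tuples_iff intro: subsetD[OF _ nth_mem])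
  ultimately show "projection A n i \<in> Pol A Rs" by (simp add: Pol_def)
next
  fix m n g fs
  assume g: "(m, g) \<in> Pol A Rs" and m: "length fs = m" and fs: "\<forall>f\<in>set fs. (n, f) \<in> Pol A Rs"
  \<comment> \<open>Operations have positive arity: \<open>m \<ge> 1\<close> makes \<open>fs\<close>
    nonempty, and any member of \<open>fs\<close> then yields \<open>n \<ge> 1\<close>.\<close>
  have "m \<ge> 1" using g by (auto simp: Pol_def operations_def)
  then obtain f0 where "f0 \<in> set fs" using m by (cases fs) auto
  then have n1: "n \<ge> 1" using fs by (auto simp: Pol_def operations_def)
  have "map (\<lambda>f. f xs) fs \<in> tuples A m" if "xs \<in> tuples A n" for xs
    using fs m that by (fastforce simp: Pol_def operations_def tuples_iff)
  then have op: "compose_op A n g fs \<in> operations A"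
    using n1 g by (fastforce simp: compose_op_def operations_def Pol_def)
  have "preserves (compose_op A n g fs) R" if R: "R \<in> Rs" for R
    unfolding preserves_def
  proof (intro allI impI)
    fix ts assume ts: "length ts = fst (compose_op A n g fs)" "set ts \<subseteq> snd R"
    have n: "length ts = n" using ts by (simp add: compose_op_def)
    have col: "map (\<lambda>t. t ! j) ts \<in> tuples A n" if "j < fst R" for j
      using assms[OF R] ts(2) n that by (fastforce simp: tuples_iff)
    \<comment> \<open>Each inner operation turns the tuples \<open>ts\<close> into one tuple of
      \<open>R\<close>; these tuples are the input for \<open>g\<close>.\<close>
    define us where "us = map (\<lambda>f. map (\<lambda>i. f (map (\<lambda>t. t ! i) ts)) [0..<fst R]) fs"
    have "set us \<subseteq> snd R"
      using fs R n ts(2) by (auto simp: us_def Pol_def preserves_def)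
    moreover have "length us = m" using m by (simp add: us_def)
    ultimately have "map (\<lambda>i. g (map (\<lambda>t. t ! i) us)) [0..<fst R] \<in> snd R"
      using g R by (auto simp: Pol_def preserves_def)
    moreover have "map (\<lambda>i. g (map (\<lambda>t. t ! i) us)) [0..<fst R] =
      map (\<lambda>i. snd (compose_op A n g fs) (map (\<lambda>t. t ! i) ts)) [0..<fst R]"
      using col by (auto simp: compose_op_def us_def comp_def intro!: arg_cong[of _ _ g])
    ultimately show "map (\<lambda>i. snd (compose_op A n g fs) (map (\<lambda>t. t ! i) ts)) [0..<fst R] \<in> snd R"
      by simp
  qed
  then show "compose_op A n g fs \<in> Pol A Rs" using op by (simp add: Pol_def)
qed

section \<open>Substitution as colour-preserving maps of powers\<close>

lemma clone_leE:
  assumes "clone_le A C (n, f) (m, g)" and "C \<subseteq> operations A"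
  obtains hs where "length hs = m" "\<And>h. h \<in> set hs \<Longrightarrow> (n, h) \<in> C"
    "\<And>xs. xs \<in> tuples A n \<Longrightarrow> map (\<lambda>h. h xs) hs \<in> tuples A m"
    "\<And>xs. xs \<in> tuples A n \<Longrightarrow> f xs = g (map (\<lambda>h. h xs) hs)"
proof -
  from assms(1) obtain hs where hs: "length hs = m" "\<forall>h\<in>set hs. (n, h) \<in> C"
    and f: "(n, f) = compose_op A n g hs"
    unfolding clone_le_def fst_conv snd_conv by blast
  have "map (\<lambda>h. h xs) hs \<in> tuples A m" if "xs \<in> tuples A n" for xs
    using hs assms(2) that by (fastforce simp: operations_def tuples_iff)
  moreover have "f xs = g (map (\<lambda>h. h xs) hs)" if "xs \<in> tuples A n" for xs
    using f that by (simp add: compose_op_def)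
  ultimately show thesis using that hs by blast
qed

text \<open>Together with \<open>clone_leE\<close> this trades a list of clone members for one map
  of powers with coordinates in the clone.\<close>

lemma clone_leI:
  assumes "(n, f) \<in> operations A"
    and H: "\<And>xs. xs \<in> tuples A n \<Longrightarrow> H xs \<in> tuples A m"
    and f: "\<And>xs. xs \<in> tuples A n \<Longrightarrow> f xs = g (H xs)"
    and C: "\<And>i. i < m \<Longrightarrow> (n, \<lambda>xs\<in>tuples A n. H xs ! i) \<in> C"
  shows "clone_le A C (n, f) (m, g)"
proof -
  define hs where "hs = map (\<lambda>i. \<lambda>xs\<in>tuples A n. H xs ! i) [0..<m]"
  have H_eq: "map (\<lambda>h. h xs) hs = H xs" if "xs \<in> tuples A n" for xs
    using H[OF that] that by (auto simp: hs_def tuples_iff intro!: nth_equalityI)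
  \<comment> \<open>Outside \<open>tuples A n\<close> both sides are \<open>undefined\<close> by
    extensionality.\<close>
  have "f = (\<lambda>xs\<in>tuples A n. g (map (\<lambda>h. h xs) hs))"
  proof
    fix xs
    have "f \<in> extensional (tuples A n)" using assms(1) by (simp add: operations_def PiE_def)
    then show "f xs = (\<lambda>xs\<in>tuples A n. g (map (\<lambda>h. h xs) hs)) xs"
      using f H_eq by (cases "xs \<in> tuples A n") (auto simp: extensional_def)
  qed
  then have "(n, f) = compose_op A n g hs" by (simp add: compose_op_def)
  moreover have "\<forall>h\<in>set hs. (n, h) \<in> C" using C by (auto simp: hs_def)
  moreover have "length hs = m" by (simp add: hs_def)
  ultimately show ?thesis unfolding clone_le_def fst_conv snd_conv by blast
qed

lemma clone_le_refl:
  assumes "clone A C" "F \<in> operations A"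
  shows "clone_le A C F F"
proof -
  obtain n f where F: "F = (n, f)" by (cases F)
  show ?thesis
    unfolding F
  proof (rule clone_leI[where H = "\<lambda>xs. xs"])
    show "(n, \<lambda>xs\<in>tuples A n. xs ! i) \<in> C" if "i < n" for i
      using assms(1) that by (auto simp: clone_def projection_def)
  qed (use assms F in auto)
qed

lemma clone_le_trans:
  assumes C: "clone A C" and F: "F \<in> operations A"
    and FG: "clone_le A C F G" and GK: "clone_le A C G K"
  shows "clone_le A C F K"
proof -
  obtain n f where Fe: "F = (n, f)" by (cases F)
  obtain m g where Ge: "G = (m, g)" by (cases G)
  obtain l k where Ke: "K = (l, k)" by (cases K)
  have sub: "C \<subseteq> operations A" using C by (simp add: clone_def)
  obtain hs where hs: "length hs = m" "\<And>h. h \<in> set hs \<Longrightarrow> (n, h) \<in> C"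
    "\<And>xs. xs \<in> tuples A n \<Longrightarrow> map (\<lambda>h. h xs) hs \<in> tuples A m"
    "\<And>xs. xs \<in> tuples A n \<Longrightarrow> f xs = g (map (\<lambda>h. h xs) hs)"
    using clone_leE[OF FG[unfolded Fe Ge] sub] by blast
  obtain hs' where hs': "length hs' = l" "\<And>h. h \<in> set hs' \<Longrightarrow> (m, h) \<in> C"
    "\<And>xs. xs \<in> tuples A m \<Longrightarrow> map (\<lambda>h. h xs) hs' \<in> tuples A l"
    "\<And>xs. xs \<in> tuples A m \<Longrightarrow> g xs = k (map (\<lambda>h. h xs) hs')"
    using clone_leE[OF GK[unfolded Ge Ke] sub] by blast
  show ?thesis
    unfolding Fe Ke
  proof (rule clone_leI[where H = "\<lambda>xs. map (\<lambda>h. h (map (\<lambda>h. h xs) hs)) hs'"])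
    fix i assume i: "i < l"
    have "(m, hs' ! i) \<in> C" using hs'(1,2) i by simp
    then have "compose_op A n (hs' ! i) hs \<in> C"
      using C hs(1,2) unfolding clone_def by blast
    then show "(n, \<lambda>xs\<in>tuples A n. map (\<lambda>h. h (map (\<lambda>h. h xs) hs)) hs' ! i) \<in> C"
      using i hs'(1) by (simp add: compose_op_def cong: restrict_cong)
  qed (use F Fe hs(3,4) hs'(3,4) in auto)
qed

lemma equiv_clone_equiv:
  assumes "clone A C"
  shows "equiv (operations A) (clone_equiv A C)"
proof (rule equivI)
  show "clone_equiv A C \<subseteq> operations A \<times> operations A" by (auto simp: clone_equiv_def)
  show "refl_on (operations A) (clone_equiv A C)"
    using clone_le_refl[OF assms] by (auto simp: refl_on_def clone_equiv_def)
  show "sym (clone_equiv A C)" by (auto simp: sym_def clone_equiv_def)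
  show "trans (clone_equiv A C)"
    by (intro transI) (auto simp: clone_equiv_def dest: clone_le_trans[OF assms])
qed

section \<open>Incomparable equivalence relations\<close>

definition alternating_walk ::
  "'a set \<Rightarrow> 'a rel \<Rightarrow> 'a rel \<Rightarrow> 'a \<Rightarrow> 'a \<Rightarrow> 'a operation \<Rightarrow> nat \<Rightarrow> (nat \<Rightarrow> 'a list) \<Rightarrow> bool" where
  "alternating_walk A \<alpha> \<beta> u v F L y \<longleftrightarrow>
     (\<forall>i\<le>L. y i \<in> tuples A (fst F) \<and> snd F (y i) = (if even i then u else v)) \<and>
     (\<forall>i<L. (y i, y (Suc i)) \<in> listrel (if even i then \<alpha> else \<beta>))"

text \<open>The members of \<open>hs\<close> preserve both relations, so the map of powers they form
  carries steps to steps; it keeps colours because \<open>f\<close> is \<open>g\<close> after this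
  map.\<close>

lemma alternating_walk_mono:
  assumes C: "C \<subseteq> operations A"
    and pres: "\<And>F. F \<in> C \<Longrightarrow> preserves F (binary_relation \<alpha>)"
      "\<And>F. F \<in> C \<Longrightarrow> preserves F (binary_relation \<beta>)"
    and le: "clone_le A C F G" and walk: "alternating_walk A \<alpha> \<beta> u v F L y"
  shows "\<exists>y. alternating_walk A \<alpha> \<beta> u v G L y"
proof -
  obtain n f where Fe: "F = (n, f)" by (cases F)
  obtain m g where Ge: "G = (m, g)" by (cases G)
  obtain hs where hs: "length hs = m" "\<And>h. h \<in> set hs \<Longrightarrow> (n, h) \<in> C"
    "\<And>xs. xs \<in> tuples A n \<Longrightarrow> map (\<lambda>h. h xs) hs \<in> tuples A m"
    "\<And>xs. xs \<in> tuples A n \<Longrightarrow> f xs = g (map (\<lambda>h. h xs) hs)"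
    using clone_leE[OF le[unfolded Fe Ge] C] by blast
  have step: "(map (\<lambda>h. h xs) hs, map (\<lambda>h. h ys) hs) \<in> listrel \<theta>"
    if pres_\<theta>: "\<And>F. F \<in> C \<Longrightarrow> preserves F (binary_relation \<theta>)"
      and xs: "xs \<in> tuples A n" and xy: "(xs, ys) \<in> listrel \<theta>"
    for \<theta> xs ys
  proof -
    have "(h xs, h ys) \<in> \<theta>" if h: "h \<in> set hs" for h
    proof -
      have "preserves (n, h) (binary_relation \<theta>)" using pres_\<theta> hs(2)[OF h] .
      then show ?thesis using xs xy by (simp add: preserves_binary_iff tuples_iff)
    qed
    then show ?thesis by (simp add: listrel_iff_nth)
  qed
  have "alternating_walk A \<alpha> \<beta> u v G L (\<lambda>i. map (\<lambda>h. h (y i)) hs)"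
    unfolding alternating_walk_def
  proof (intro conjI allI impI)
    fix i assume "i \<le> L"
    then show "map (\<lambda>h. h (y i)) hs \<in> tuples A (fst G)"
      "snd G (map (\<lambda>h. h (y i)) hs) = (if even i then u else v)"
      using walk hs(3,4)[of "y i"] by (auto simp: alternating_walk_def Fe Ge)
  next
    fix i assume i: "i < L"
    then have "y i \<in> tuples A n" using walk by (auto simp: alternating_walk_def Fe)
    then show "(map (\<lambda>h. h (y i)) hs, map (\<lambda>h. h (y (Suc i))) hs)
        \<in> listrel (if even i then \<alpha> else \<beta>)"
      using step[OF pres(1), of "y i" "y (Suc i)"] step[OF pres(2), of "y i" "y (Suc i)"] walk i
      by (auto simp: alternating_walk_def)
  qed
  then show ?thesis by blast
qed

text \<open>The point \<open>zigzag a b c d L i\<close> is the \<open>i\<close>-th point of a path in \<open>A\<^sup>L\<close> whose \<open>k\<close>-th step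
  changes only coordinate \<open>k\<close>: from \<open>a\<close> to \<open>b\<close> for even \<open>k\<close> and from \<open>c\<close> to \<open>d\<close> for odd \<open>k\<close>.\<close>

definition zigzag :: "'a \<Rightarrow> 'a \<Rightarrow> 'a \<Rightarrow> 'a \<Rightarrow> nat \<Rightarrow> nat \<Rightarrow> 'a list" where
  "zigzag a b c d L i =
     map (\<lambda>k. if even k then (if i \<le> k then a else b) else (if i \<le> k then c else d)) [0..<L]"

lemma length_zigzag [simp]: "length (zigzag a b c d L i) = L"
  by (simp add: zigzag_def)

lemma nth_zigzag [simp]:
  "k < L \<Longrightarrow> zigzag a b c d L i ! k =
     (if even k then (if i \<le> k then a else b) else (if i \<le> k then c else d))"
  by (simp add: zigzag_def)

text \<open>Two zigzag points differ exactly in the coordinates changed between them. Unless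
  \<open>j = Suc i\<close>, an odd coordinate is among these, \<open>Suc i\<close> going forward or
  \<open>j\<close> going back, and there \<open>c\<close> and \<open>d\<close> would have to be
  \<alpha>-related.\<close>

lemma zigzag_alpha:
  assumes "sym \<alpha>" "(c, d) \<notin> \<alpha>" "even i" "odd j" "i \<le> L" "j \<le> L"
    and "(zigzag a b c d L i, zigzag a b c d L j) \<in> listrel \<alpha>"
  shows "j = Suc i"
proof (rule ccontr)
  assume "j \<noteq> Suc i"
  have nth: "(zigzag a b c d L i ! k, zigzag a b c d L j ! k) \<in> \<alpha>" if "k < L" for k
    using assms(7) that by (auto simp: listrel_iff_nth)
  show False
  proof (cases "i < j")
    case True
    then have "Suc i < j" using \<open>j \<noteq> Suc i\<close> by simp
    then have "(c, d) \<in> \<alpha>" using nth[of "Suc i"] assms(3,4,6) by simp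
    then show False using assms(2) by simp
  next
    case False
    then have "j < i" using assms(3,4) by (metis linorder_neqE_nat)
    then have "(d, c) \<in> \<alpha>" using nth[of j] assms(3,4,5) by simp
    then show False using assms(1,2) by (auto dest: symD)
  qed
qed

text \<open>The same argument with an even coordinate, where \<open>a\<close> and \<open>b\<close>
  would have to be \<beta>-related. Hence an alternating walk on the zigzag can neither jump ahead
  nor turn back.\<close>

lemma zigzag_beta:
  assumes "sym \<beta>" "(a, b) \<notin> \<beta>" "odd i" "even j" "i \<le> L" "j \<le> L"
    and "(zigzag a b c d L i, zigzag a b c d L j) \<in> listrel \<beta>"
  shows "j = Suc i"
proof (rule ccontr)
  assume "j \<noteq> Suc i"
  have nth: "(zigzag a b c d L i ! k, zigzag a b c d L j ! k) \<in> \<beta>" if "k < L" for k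
    using assms(7) that by (auto simp: listrel_iff_nth)
  show False
  proof (cases "i < j")
    case True
    then have "Suc i < j" using \<open>j \<noteq> Suc i\<close> by simp
    then have "(a, b) \<in> \<beta>" using nth[of "Suc i"] assms(3,4,6) by simp
    then show False using assms(2) by simp
  next
    case False
    then have "j < i" using assms(3,4) by (metis linorder_neqE_nat)
    then have "(b, a) \<in> \<beta>" using nth[of j] assms(3,4,5) by simp
    then show False using assms(1,2) by (auto dest: symD)
  qed
qed

section \<open>Infinitely many classes from two incomparable relations\<close>

lemma infinite_classes_if_incomparable:
  assumes C: "clone A C" and \<alpha>: "equiv A \<alpha>" and \<beta>: "equiv A \<beta>"
    and pres: "\<And>F. F \<in> C \<Longrightarrow> preserves F (binary_relation \<alpha>)"
      "\<And>F. F \<in> C \<Longrightarrow> preserves F (binary_relation \<beta>)"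
    and incomparable: "\<not> \<alpha> \<subseteq> \<beta>" "\<not> \<beta> \<subseteq> \<alpha>"
  shows "infinite (operations A // clone_equiv A C)"
proof -
  obtain a b where ab: "(a, b) \<in> \<alpha>" "(a, b) \<notin> \<beta>" using incomparable by auto
  obtain c d where cd: "(c, d) \<in> \<beta>" "(c, d) \<notin> \<alpha>" using incomparable by auto
  have abcd: "a \<in> A" "b \<in> A" "c \<in> A" "d \<in> A"
    using ab cd \<alpha> \<beta> by (auto dest: equivE equiv_type)
  have sym: "sym \<alpha>" "sym \<beta>" using \<alpha> \<beta> by (auto elim: equivE)
  have refl: "(x, x) \<in> \<alpha>" "(x, x) \<in> \<beta>" if "x \<in> A" for x
    using \<alpha> \<beta> that by (auto elim!: equivE dest: refl_onD)
  have neq: "a \<noteq> b" "c \<noteq> d" using ab cd refl abcd by auto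
  \<comment> \<open>A third colour exists: if \<open>c\<close> is \<open>a\<close> or
    \<open>b\<close>, then \<open>d\<close> is neither, since otherwise \<open>(c, d)\<close> would
    be in \<alpha>.\<close>
  obtain w where w: "w \<in> A" "w \<noteq> a" "w \<noteq> b"
  proof (cases "c = a \<or> c = b")
    case True
    then have "d \<noteq> a" "d \<noteq> b" using ab cd neq sym by (auto dest: symD)
    then show thesis using that abcd by blast
  qed (use that abcd in blast)
  define z where "z = zigzag a b c d"
  have z_tuple: "z L i \<in> tuples A L" for L i
    using abcd by (auto simp: z_def zigzag_def tuples_iff)
  \<comment> \<open>The zigzag is coloured alternately \<open>a\<close> and \<open>b\<close>, and
    all other points get \<open>w\<close>; thus a walk using only the colours \<open>a\<close> and
    \<open>b\<close> stays on the zigzag.\<close>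
  define f where "f L = (\<lambda>x\<in>tuples A L. if \<exists>i\<le>L. even i \<and> x = z L i then a
    else if \<exists>i\<le>L. odd i \<and> x = z L i then b else w)" for L
  \<comment> \<open>The arity is shifted to \<open>Suc L\<close> because operations of arity 0 are
    excluded.\<close>
  have f_op: "(Suc L, f (Suc L)) \<in> operations A" for L
    using abcd w by (auto simp: operations_def f_def)
  have z_inj: "z L i \<noteq> z L j" if "i < j" "j \<le> L" for L i j
  proof
    assume "z L i = z L j"
    then have "z L i ! i = z L j ! i" by simp
    then show False using that neq by (auto simp: z_def split: if_splits)
  qed
  have z_eq_iff: "z L i = z L j \<longleftrightarrow> i = j" if "i \<le> L" "j \<le> L" for L i j
    using that z_inj by (metis linorder_neqE_nat)
  have f_z: "f L (z L i) = (if even i then a else b)" if "i \<le> L" for L i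
    using that z_tuple by (auto simp: f_def z_eq_iff)
  have f_a: "\<exists>i\<le>L. even i \<and> x = z L i" if "x \<in> tuples A L" "f L x = a" for L x
    using that neq w by (auto simp: f_def split: if_splits)
  have f_b: "\<exists>i\<le>L. odd i \<and> x = z L i" if "x \<in> tuples A L" "f L x = b" for L x
    using that neq w by (auto simp: f_def split: if_splits)
  have walk: "alternating_walk A \<alpha> \<beta> a b (L, f L) L (z L)" for L
    using f_z z_tuple ab cd abcd refl
    by (auto simp: alternating_walk_def z_def listrel_iff_nth not_less_eq_eq le_Suc_eq)
  have bound: "K \<le> L" if y: "alternating_walk A \<alpha> \<beta> a b (L, f L) K y" for K L y
  proof -
    \<comment> \<open>The walk may enter the zigzag at any even index, but each step then advances
      by exactly one, so after \<open>k\<close> steps the index is at least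
      \<open>k\<close>.\<close>
    have "\<exists>j\<le>L. k \<le> j \<and> (even j \<longleftrightarrow> even k) \<and> y k = z L j" if "k \<le> K" for k
      using that
    proof (induction k)
      case 0
      then show ?case using y f_a by (auto simp: alternating_walk_def)
    next
      case (Suc k)
      then obtain j where j: "j \<le> L" "k \<le> j" "even j \<longleftrightarrow> even k" "y k = z L j" by auto
      have yk: "y (Suc k) \<in> tuples A L" "f L (y (Suc k)) = (if even (Suc k) then a else b)"
        using y Suc.prems by (auto simp: alternating_walk_def)
      obtain j' where j': "j' \<le> L" "even j' \<longleftrightarrow> even (Suc k)" "y (Suc k) = z L j'"
        using f_a[OF yk(1)] f_b[OF yk(1)] yk(2) by (cases "even k") auto
      have "(z L j, z L j') \<in> listrel (if even k then \<alpha> else \<beta>)"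
        using y Suc.prems j(4) j'(3) unfolding alternating_walk_def by (metis Suc_le_lessD)
      then have "j' = Suc j"
        using zigzag_alpha[OF sym(1) cd(2), of j j' L a b] zigzag_beta[OF sym(2) ab(2), of j j' L c d]
          j j' by (cases "even k") (auto simp: z_def)
      then show ?case using j j' by auto
    qed
    from this[of K] show ?thesis by auto
  qed
  define cls where "cls L = clone_equiv A C `` {(Suc L, f (Suc L))}" for L
  have "inj cls"
  proof (rule injI)
    fix K L assume eq: "cls K = cls L"
    have eqv: "((Suc K, f (Suc K)), (Suc L, f (Suc L))) \<in> clone_equiv A C"
      using eq_equiv_class[OF eq[unfolded cls_def] equiv_clone_equiv[OF C] f_op] .
    have sub: "C \<subseteq> operations A" using C by (simp add: clone_def)
    have "clone_le A C (Suc K, f (Suc K)) (Suc L, f (Suc L))"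
      "clone_le A C (Suc L, f (Suc L)) (Suc K, f (Suc K))"
      using eqv by (auto simp: clone_equiv_def)
    then have "Suc K \<le> Suc L" "Suc L \<le> Suc K"
      using alternating_walk_mono[OF sub pres _ walk] bound by blast+
    then show "K = L" by simp
  qed
  moreover have "range cls \<subseteq> operations A // clone_equiv A C"
    using f_op by (auto simp: cls_def quotient_def)
  ultimately show ?thesis by (meson finite_imageD finite_subset infinite_UNIV_nat)
qed

section \<open>Chains of equivalence relations\<close>

text \<open>Invariants with values in different types are recoded as numbers, so that
  \<open>classifies\<close> can keep one type throughout the induction.\<close>

lemma finite_range_to_nat:
  assumes "finite (\<Phi> ` D)"
  shows "\<exists>T :: 'b \<Rightarrow> nat. finite (T ` D) \<and> (\<forall>p\<in>D. \<forall>q\<in>D. T p = T q \<longrightarrow> \<Phi> p = \<Phi> q)"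
proof -
  obtain e :: "_ \<Rightarrow> nat" where e: "inj_on e (\<Phi> ` D)"
    using finite_imp_inj_to_nat_seg[OF assms] by blast
  have "finite ((\<lambda>p. e (\<Phi> p)) ` D)"
    using finite_imageI[OF assms, of e] by (simp add: image_image)
  moreover have "\<forall>p\<in>D. \<forall>q\<in>D. e (\<Phi> p) = e (\<Phi> q) \<longrightarrow> \<Phi> p = \<Phi> q"
    using e by (auto dest: inj_onD)
  ultimately show ?thesis by (intro exI[of _ "\<lambda>p. e (\<Phi> p)"] conjI)
qed

text \<open>The bottom and top relations are included so that the induction starts where blocks are
  points and ends where a whole power is one block.\<close>

locale equivalence_chain =
  fixes A :: "'a set" and E :: "'a rel set"
  assumes finite_A: "finite A"
    and equiv_E: "\<theta> \<in> E \<Longrightarrow> equiv A \<theta>"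
    and chain: "\<theta> \<in> E \<Longrightarrow> \<theta>' \<in> E \<Longrightarrow> \<theta> \<subseteq> \<theta>' \<or> \<theta>' \<subseteq> \<theta>"
    and Id_in: "Id_on A \<in> E" and total_in: "A \<times> A \<in> E"
begin

section \<open>The automorphism group of the chain\<close>

definition G :: "('a \<Rightarrow> 'a) set" where
  "G = {g. g permutes A \<and> (\<forall>\<theta>\<in>E. \<forall>a\<in>A. \<forall>b\<in>A. (g a, g b) \<in> \<theta> \<longleftrightarrow> (a, b) \<in> \<theta>)}"

lemma finite_G: "finite G"
  by (rule finite_subset[OF _ finite_permutations[OF finite_A]]) (auto simp: G_def)

lemma id_G: "id \<in> G"
  by (simp add: G_def permutes_id)

lemma comp_G: "g \<in> G \<Longrightarrow> h \<in> G \<Longrightarrow> g \<circ> h \<in> G"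
  by (auto simp: G_def permutes_compose permutes_in_image)

lemma inv_G: "g \<in> G \<Longrightarrow> inv g \<in> G"
proof -
  assume g: "g \<in> G"
  then have p: "g permutes A" by (simp add: G_def)
  have "(inv g a, inv g b) \<in> \<theta> \<longleftrightarrow> (a, b) \<in> \<theta>" if "\<theta> \<in> E" "a \<in> A" "b \<in> A" for \<theta> a b
  proof -
    have "inv g a \<in> A" "inv g b \<in> A"
      using that permutes_in_image[OF permutes_inv[OF p]] by auto
    then show ?thesis
      using g that permutes_inverses(1)[OF p] unfolding G_def by fastforce
  qed
  then show ?thesis using permutes_inv[OF p] by (simp add: G_def)
qed

lemma map_inv_G: "g \<in> G \<Longrightarrow> map (inv g) (map g x) = x" "g \<in> G \<Longrightarrow> map g (map (inv g) x) = x"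
  by (auto simp: G_def permutes_inverses comp_def)

lemma map_G_tuples: "g \<in> G \<Longrightarrow> map g x \<in> tuples A n \<longleftrightarrow> x \<in> tuples A n"
  by (auto simp: G_def tuples_iff permutes_in_image)

lemma map_G_listrel:
  assumes "g \<in> G" "\<theta> \<in> E" "(x, y) \<in> listrel \<theta>"
  shows "(map g x, map g y) \<in> listrel \<theta>"
proof -
  have "\<theta> \<subseteq> A \<times> A" using equiv_E[OF assms(2)] by (rule equiv_type)
  then show ?thesis using assms by (fastforce simp: listrel_iff_nth G_def)
qed

lemma listrel_E:
  assumes "\<theta> \<in> E"
  shows "x \<in> tuples A n \<Longrightarrow> (x, x) \<in> listrel \<theta>"
    and "(x, y) \<in> listrel \<theta> \<Longrightarrow> (y, x) \<in> listrel \<theta>"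
    and "(x, y) \<in> listrel \<theta> \<Longrightarrow> (y, z) \<in> listrel \<theta> \<Longrightarrow> (x, z) \<in> listrel \<theta>"
proof -
  have e: "equiv (lists A) (listrel \<theta>)" using equiv_listrel[OF equiv_E[OF assms]] .
  show "(x, x) \<in> listrel \<theta>" if "x \<in> tuples A n"
    using e that by (auto elim!: equivE simp: tuples_iff intro!: refl_onD)
  show "(x, y) \<in> listrel \<theta> \<Longrightarrow> (y, x) \<in> listrel \<theta>"
    using e by (auto elim!: equivE dest: symD)
  show "(x, y) \<in> listrel \<theta> \<Longrightarrow> (y, z) \<in> listrel \<theta> \<Longrightarrow> (x, z) \<in> listrel \<theta>"
    using e by (auto elim!: equivE dest: transD)
qed

section \<open>Orbits of blocks and their types\<close>

text \<open>The base point \<open>x\<close> names its block modulo any member of \<open>E\<close>,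
  so types at all levels are functions on this one set.\<close>

definition pointed :: "(nat \<times> ('a list \<Rightarrow> 'a) \<times> 'a list) set" where
  "pointed = {(n, f, x). (n, f) \<in> operations A \<and> x \<in> tuples A n}"

text \<open>Taking the union over the whole orbit of the block gives a domain closed under
  \<open>G\<close>, on which equivariance makes sense.\<close>

definition sat :: "'a rel \<Rightarrow> 'a list \<Rightarrow> 'a list set" where
  "sat \<theta> x = {z \<in> tuples A (length x). \<exists>g\<in>G. (z, map g x) \<in> listrel \<theta>}"

lemma sat_self: "x \<in> tuples A n \<Longrightarrow> \<theta> \<in> E \<Longrightarrow> x \<in> sat \<theta> x"
  using listrel_E(1)[of \<theta> x n] id_G by (auto simp: sat_def tuples_iff intro!: bexI[of _ id])

lemma sat_tuples: "z \<in> sat \<theta> x \<Longrightarrow> x \<in> tuples A n \<Longrightarrow> z \<in> tuples A n"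
  by (auto simp: sat_def tuples_iff)

lemma sat_map:
  assumes "z \<in> sat \<theta> x" "g \<in> G" "\<theta> \<in> E"
  shows "map g z \<in> sat \<theta> x"
proof -
  obtain h where h: "h \<in> G" "(z, map h x) \<in> listrel \<theta>" and z: "z \<in> tuples A (length x)"
    using assms by (auto simp: sat_def)
  have "(map g z, map (g \<circ> h) x) \<in> listrel \<theta>"
    using map_G_listrel[OF assms(2,3) h(2)] by simp
  then show ?thesis
    using comp_G[OF assms(2) h(1)] z map_G_tuples[OF assms(2)] unfolding sat_def by blast
qed

lemma sat_listrel:
  assumes "z \<in> sat \<theta> x" "\<theta> \<in> E" "z' \<in> tuples A n" "(z', z) \<in> listrel \<theta>"
  shows "z' \<in> sat \<theta> x"
proof -
  have "z' \<in> tuples A (length x)"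
    using assms by (auto simp: sat_def tuples_iff listrel_iff_nth)
  then show ?thesis using assms listrel_E(3)[OF assms(2,4)] by (auto simp: sat_def)
qed

text \<open>A partial homomorphism from \<open>(A\<^sup>n, f)\<close> to \<open>(A\<^sup>m, f')\<close>, defined on the union of the
  \<open>\<theta>\<close>-blocks in the orbit of the \<open>\<theta>\<close>-block of \<open>x\<close>, that sends the block of \<open>x\<close> to the block of \<open>y\<close>.\<close>

definition block_hom ::
  "'a rel \<Rightarrow> ('a list \<Rightarrow> 'a) \<Rightarrow> 'a list \<Rightarrow> ('a list \<Rightarrow> 'a) \<Rightarrow> 'a list \<Rightarrow> ('a list \<Rightarrow> 'a list) \<Rightarrow> bool"
where
  "block_hom \<theta> f x f' y h \<longleftrightarrow>
     (\<forall>z\<in>sat \<theta> x. h z \<in> tuples A (length y) \<and> f z = f' (h z) \<and> set (h z) \<subseteq> set z) \<and>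
     (\<forall>z\<in>sat \<theta> x. \<forall>g\<in>G. h (map g z) = map g (h z)) \<and>
     (\<forall>\<theta>'\<in>E. \<theta>' \<subseteq> \<theta> \<longrightarrow> (\<forall>z\<in>sat \<theta> x. \<forall>z'\<in>sat \<theta> x.
        (z, z') \<in> listrel \<theta>' \<longrightarrow> (h z, h z') \<in> listrel \<theta>')) \<and>
     (h x, y) \<in> listrel \<theta>"

text \<open>Equality of types is symmetric, so homomorphisms in one direction yield those in the
  other.\<close>

definition classifies :: "(nat \<times> ('a list \<Rightarrow> 'a) \<times> 'a list \<Rightarrow> nat) \<Rightarrow> 'a rel \<Rightarrow> bool" where
  "classifies T \<theta> \<longleftrightarrow> finite (T ` pointed) \<and>
     (\<forall>n f x m f' y. (n, f, x) \<in> pointed \<longrightarrow> (m, f', y) \<in> pointed \<longrightarrow>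
        T (n, f, x) = T (m, f', y) \<longrightarrow> (\<exists>h. block_hom \<theta> f x f' y h))"

lemma listrel_Id_on: "(x, y) \<in> listrel (Id_on A) \<Longrightarrow> x = y"
  by (auto simp: listrel_iff_nth intro!: nth_equalityI)

text \<open>Blocks are points here, so \<open>sat\<close> is the orbit of \<open>x\<close>, and the
  homomorphism sends \<open>map g x\<close> to \<open>map g y\<close>.\<close>

lemma classifies_Id: "\<exists>T. classifies T (Id_on A)"
proof -
  \<comment> \<open>The stabiliser makes the orbit map well defined, the colours along the orbit
    make it respect \<open>f\<close> and \<open>f'\<close>, and the set of entries gives
    \<open>set (h z) \<subseteq> set z\<close>.\<close>
  define \<Phi> where "\<Phi> = (\<lambda>(n :: nat, f, x).
    ({g\<in>G. map g x = x}, (\<lambda>g\<in>G. f (map g x) :: 'a), set x))"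
  have "\<Phi> ` pointed \<subseteq> Pow G \<times> (G \<rightarrow>\<^sub>E A) \<times> Pow A"
  proof (rule image_subsetI)
    fix p assume "p \<in> pointed"
    then obtain n f x where p: "p = (n, f, x)" and f: "f \<in> tuples A n \<rightarrow>\<^sub>E A" and x: "x \<in> tuples A n"
      by (auto simp: pointed_def operations_def)
    have "f (map g x) \<in> A" if "g \<in> G" for g
      using PiE_mem[OF f] map_G_tuples[OF that] x by blast
    moreover have "set x \<subseteq> A" using x by (simp add: tuples_iff)
    ultimately show "\<Phi> p \<in> Pow G \<times> (G \<rightarrow>\<^sub>E A) \<times> Pow A"
      by (auto simp: \<Phi>_def p)
  qed
  moreover have "finite (Pow G \<times> (G \<rightarrow>\<^sub>E A) \<times> Pow A)"
    using finite_G finite_A by (auto intro: finite_PiE)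
  ultimately have "finite (\<Phi> ` pointed)" by (rule finite_subset)
  from finite_range_to_nat[OF this] obtain T :: "_ \<Rightarrow> nat" where T: "finite (T ` pointed)"
    "\<forall>p\<in>pointed. \<forall>q\<in>pointed. T p = T q \<longrightarrow> \<Phi> p = \<Phi> q"
    by blast
  have "\<exists>h. block_hom (Id_on A) f x f' y h"
    if p: "(n, f, x) \<in> pointed" and q: "(m, f', y) \<in> pointed"
      and eq: "T (n, f, x) = T (m, f', y)" for n f x m f' y
  proof -
    have \<Phi>: "\<Phi> (n, f, x) = \<Phi> (m, f', y)" using T(2) p q eq by blast
    have stab: "map g x = x \<longleftrightarrow> map g y = y" if "g \<in> G" for g
      using \<Phi> that by (auto simp: \<Phi>_def)
    have col: "f (map g x) = f' (map g y)" if "g \<in> G" for g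
    proof -
      have "(\<lambda>g\<in>G. f (map g x)) = (\<lambda>g\<in>G. f' (map g y))" using \<Phi> by (simp add: \<Phi>_def)
      then show ?thesis using that by (metis restrict_apply')
    qed
    have set: "set x = set y" using \<Phi> by (auto simp: \<Phi>_def)
    have xy: "x \<in> tuples A n" "y \<in> tuples A m" using p q by (auto simp: pointed_def)
    \<comment> \<open>Two possible choices of \<open>g\<close> differ by an element of the
      stabiliser of \<open>x\<close>, which by \<open>stab\<close> also fixes
      \<open>y\<close>.\<close>
    define h where "h z = map (SOME g. g \<in> G \<and> z = map g x) y" for z
    have h: "h (map g x) = map g y" if g: "g \<in> G" for g
    proof -
      define g' where "g' = (SOME g'. g' \<in> G \<and> map g x = map g' x)"
      have g': "g' \<in> G" "map g x = map g' x"
        using someI[of "\<lambda>g'. g' \<in> G \<and> map g x = map g' x" g] g by (auto simp: g'_def)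
      have "map (inv g \<circ> g') x = map (inv g) (map g x)" using g'(2) by simp
      then have "map (inv g \<circ> g') y = y"
        using stab[OF comp_G[OF inv_G[OF g] g'(1)]] map_inv_G(1)[OF g] by metis
      then have "map g (map (inv g) (map g' y)) = map g y" by simp
      then have "map g' y = map g y" using map_inv_G(2)[OF g] by metis
      then show ?thesis by (simp add: h_def g'_def)
    qed
    have sat: "\<exists>g\<in>G. z = map g x" if "z \<in> sat (Id_on A) x" for z
      using that by (auto simp: sat_def dest: listrel_Id_on)
    have "block_hom (Id_on A) f x f' y h"
      unfolding block_hom_def
    proof (intro conjI ballI impI)
      fix z assume "z \<in> sat (Id_on A) x"
      then obtain g where g: "g \<in> G" "z = map g x" using sat by blast
      show "h z \<in> tuples A (length y)"
        using h[OF g(1)] g map_G_tuples[OF g(1)] xy by (simp add: tuples_iff[of y])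
      show "f z = f' (h z)" "set (h z) \<subseteq> set z"
        using h[OF g(1)] g col set by auto
    next
      fix z g' assume "z \<in> sat (Id_on A) x" and g': "g' \<in> G"
      then obtain g where g: "g \<in> G" "z = map g x" using sat by blast
      show "h (map g' z) = map g' (h z)"
        using h[OF g(1)] h[OF comp_G[OF g' g(1)]] g by simp
    next
      fix \<theta>' z z'
      assume \<theta>': "\<theta>' \<in> E" "\<theta>' \<subseteq> Id_on A" and z: "z \<in> sat (Id_on A) x"
        and zz: "(z, z') \<in> listrel \<theta>'"
      obtain g where g: "g \<in> G" "z = map g x" using sat z by blast
      have "z = z'" using zz listrel_mono[OF \<theta>'(2)] listrel_Id_on by blast
      moreover have "h z \<in> tuples A m"
        using h[OF g(1)] g map_G_tuples[OF g(1)] xy by simp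
      ultimately show "(h z, h z') \<in> listrel \<theta>'"
        using listrel_E(1)[OF \<theta>'(1)] by blast
    next
      show "(h x, y) \<in> listrel (Id_on A)"
        using h[OF id_G] listrel_E(1)[OF Id_in xy(2)] by simp
    qed
    then show ?thesis by blast
  qed
  then show ?thesis using T(1) unfolding classifies_def by blast
qed

text \<open>A \<open>\<theta>'\<close>-block is classified by its stabiliser and the set of \<open>\<theta>\<close>-types occurring in it.
  For each orbit of \<open>\<theta>\<close>-blocks a representative inside the \<open>\<theta>'\<close>-block of \<open>x\<close> is mapped to a
  \<open>\<theta>\<close>-block of the same type inside the \<open>\<theta>'\<close>-block of \<open>y\<close>; equality of the stabilisers
  makes the union of these partial maps compatible with \<open>\<theta>'\<close>.\<close>

lemma classifies_step:
  assumes T: "classifies T \<theta>" and \<theta>: "\<theta> \<in> E" and \<theta>': "\<theta>' \<in> E" and sub: "\<theta> \<subseteq> \<theta>'"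
    and cover: "\<And>\<theta>''. \<theta>'' \<in> E \<Longrightarrow> \<theta>'' \<subseteq> \<theta>' \<Longrightarrow> \<theta>'' = \<theta>' \<or> \<theta>'' \<subseteq> \<theta>"
  shows "\<exists>T. classifies T \<theta>'"
proof -
  define blk where "blk x = {z. (z, x) \<in> listrel \<theta>'}" for x
  define \<Phi> where "\<Phi> = (\<lambda>(n :: nat, f :: 'a list \<Rightarrow> 'a, x).
    ({g\<in>G. (map g x, x) \<in> listrel \<theta>'}, (\<lambda>z. T (n, f, z)) ` blk x))"
  have \<theta>'_sub: "\<theta>' \<subseteq> A \<times> A" using equiv_E[OF \<theta>'] by (rule equiv_type)
  have blk_tuples: "z \<in> tuples A n" if "z \<in> blk x" "x \<in> tuples A n" for z x n
    using that listrel_tuples[OF \<theta>'_sub, of z x n] by (auto simp: blk_def tuples_iff)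
  have "\<Phi> ` pointed \<subseteq> Pow G \<times> Pow (T ` pointed)"
    using blk_tuples by (auto simp: \<Phi>_def pointed_def intro!: imageI)
  moreover have "finite (Pow G \<times> Pow (T ` pointed))"
    using finite_G T by (auto simp: classifies_def)
  ultimately have "finite (\<Phi> ` pointed)" by (rule finite_subset)
  from finite_range_to_nat[OF this] obtain T' :: "_ \<Rightarrow> nat" where T': "finite (T' ` pointed)"
    "\<forall>p\<in>pointed. \<forall>q\<in>pointed. T' p = T' q \<longrightarrow> \<Phi> p = \<Phi> q"
    by blast
  have lift: "(z, z') \<in> listrel \<theta>'" if "(z, z') \<in> listrel \<theta>" for z z'
    using that listrel_mono[OF sub] by blast
  have "\<exists>h. block_hom \<theta>' f x f' y h"
    if p: "(n, f, x) \<in> pointed" and q: "(m, f', y) \<in> pointed"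
      and eq: "T' (n, f, x) = T' (m, f', y)" for n f x m f' y
  proof -
    have \<Phi>: "\<Phi> (n, f, x) = \<Phi> (m, f', y)" using T'(2) p q eq by blast
    have stab: "(map g x, x) \<in> listrel \<theta>' \<longleftrightarrow> (map g y, y) \<in> listrel \<theta>'" if "g \<in> G" for g
      using \<Phi> that by (auto simp: \<Phi>_def)
    have types: "(\<lambda>z. T (n, f, z)) ` blk x = (\<lambda>z. T (m, f', z)) ` blk y"
      using \<Phi> by (auto simp: \<Phi>_def)
    have xy: "x \<in> tuples A n" "y \<in> tuples A m" using p q by (auto simp: pointed_def)
    \<comment> \<open>Equality of the type sets provides, for each \<open>r\<close> in the block of
      \<open>x\<close>, a point \<open>w\<close> of the same type in the block of
      \<open>y\<close>.\<close>
    have "\<exists>k. \<exists>w\<in>blk y. block_hom \<theta> f r f' w k" if r: "r \<in> blk x" for r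
    proof -
      obtain w where w: "w \<in> blk y" "T (n, f, r) = T (m, f', w)" using types r by blast
      moreover have "(n, f, r) \<in> pointed" "(m, f', w) \<in> pointed"
        using p q r w(1) blk_tuples by (auto simp: pointed_def)
      ultimately show ?thesis using T unfolding classifies_def by blast
    qed
    then obtain k where k: "\<And>r. r \<in> blk x \<Longrightarrow> \<exists>w\<in>blk y. block_hom \<theta> f r f' w (k r)" by metis
    \<comment> \<open>The choice depends on \<open>z\<close> only through the sets
      \<open>sat \<theta> r\<close> containing it, hence is constant on \<theta>-blocks and on
      \<open>G\<close>-orbits. So \<open>h\<close> uses one and the same partial map wherever
      equivariance or a relation inside \<theta> has to be checked.\<close>
    define rep where "rep z = (SOME r. r \<in> blk x \<and> z \<in> sat \<theta> r)" for z
    define h where "h z = k (rep z) z" for z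
    \<comment> \<open>If \<open>z\<close> is \<theta>'-related to \<open>map g x\<close>, then
      moving \<open>z\<close> back by \<open>inv g\<close> lands in the block of \<open>x\<close>,
      so a representative exists.\<close>
    have rep: "rep z \<in> blk x" "z \<in> sat \<theta> (rep z)" if z: "z \<in> sat \<theta>' x" for z
    proof -
      obtain g where g: "g \<in> G" "(z, map g x) \<in> listrel \<theta>'" and zt: "z \<in> tuples A n"
        using z xy by (auto simp: sat_def tuples_iff)
      have "(map (inv g) z, map (inv g) (map g x)) \<in> listrel \<theta>'"
        using map_G_listrel[OF inv_G[OF g(1)] \<theta>' g(2)] .
      then have "map (inv g) z \<in> blk x" using map_inv_G(1)[OF g(1)] by (simp add: blk_def)
      moreover have "z \<in> sat \<theta> (map (inv g) z)"
        using sat_map[OF sat_self[OF _ \<theta>] g(1) \<theta>, of "map (inv g) z" n]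
          map_inv_G(2)[OF g(1)] map_G_tuples[OF inv_G[OF g(1)]] zt by metis
      ultimately show "rep z \<in> blk x" "z \<in> sat \<theta> (rep z)"
        using someI[of "\<lambda>r. r \<in> blk x \<and> z \<in> sat \<theta> r" "map (inv g) z"] by (auto simp: rep_def)
    qed
    have rep_map: "rep (map g z) = rep z" if g: "g \<in> G" for g z
    proof -
      have "map g z \<in> sat \<theta> r \<longleftrightarrow> z \<in> sat \<theta> r" for r
        using sat_map[OF _ g \<theta>, of z r] sat_map[OF _ inv_G[OF g] \<theta>, of "map g z" r]
          map_inv_G(1)[OF g] by auto
      then show ?thesis by (simp add: rep_def)
    qed
    have rep_rel: "rep z = rep z'"
      if "(z, z') \<in> listrel \<theta>" "z \<in> tuples A n" "z' \<in> tuples A n" for z z'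
    proof -
      have "z \<in> sat \<theta> r \<longleftrightarrow> z' \<in> sat \<theta> r" for r
        using sat_listrel[OF _ \<theta> that(2) that(1)]
          sat_listrel[OF _ \<theta> that(3) listrel_E(2)[OF \<theta> that(1)]] by blast
      then show ?thesis by (simp add: rep_def)
    qed
    \<comment> \<open>One \<open>g\<close> takes the \<theta>'-block of \<open>x\<close> to that of
      \<open>z\<close> and the \<theta>'-block of \<open>y\<close> to that of \<open>h z\<close>:
      any \<open>g\<close> that takes the \<theta>-block of \<open>rep z\<close> to that of
      \<open>z\<close>.\<close>
    have follow: "\<exists>g\<in>G. (z, map g x) \<in> listrel \<theta>' \<and> (h z, map g y) \<in> listrel \<theta>'"
      if z: "z \<in> sat \<theta>' x" for z
    proof -
      obtain w where w: "w \<in> blk y" and hom: "block_hom \<theta> f (rep z) f' w (k (rep z))"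
        using k rep(1)[OF z] by blast
      obtain g where g: "g \<in> G" "(z, map g (rep z)) \<in> listrel \<theta>"
        using rep(2)[OF z] by (auto simp: sat_def)
      have rt: "rep z \<in> tuples A n" using blk_tuples[OF rep(1)[OF z] xy(1)] .
      have rs: "rep z \<in> sat \<theta> (rep z)" using sat_self[OF rt \<theta>] .
      have "(h z, k (rep z) (map g (rep z))) \<in> listrel \<theta>"
        using hom g rep(2)[OF z] sat_map[OF rs g(1) \<theta>] \<theta> unfolding block_hom_def h_def by blast
      moreover have "k (rep z) (map g (rep z)) = map g (k (rep z) (rep z))"
        using hom g rs unfolding block_hom_def by blast
      moreover have "(map g (k (rep z) (rep z)), map g w) \<in> listrel \<theta>"
        using hom by (intro map_G_listrel[OF g(1) \<theta>]) (simp add: block_hom_def)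
      ultimately have "(h z, map g w) \<in> listrel \<theta>'"
        using listrel_E(3)[OF \<theta>] lift by metis
      moreover have "(map g w, map g y) \<in> listrel \<theta>'"
        using map_G_listrel[OF g(1) \<theta>'] w by (simp add: blk_def)
      moreover have "(map g (rep z), map g x) \<in> listrel \<theta>'"
        using map_G_listrel[OF g(1) \<theta>'] rep(1)[OF z] by (simp add: blk_def)
      ultimately show ?thesis using g lift listrel_E(3)[OF \<theta>'] by blast
    qed
    \<comment> \<open>This is where equal stabilisers enter: \<open>inv g' \<circ> g\<close>
      stabilises the \<theta>'-block of \<open>x\<close>, hence that of \<open>y\<close>.\<close>
    have shift: "(map g y, map g' y) \<in> listrel \<theta>'"
      if g: "g \<in> G" "g' \<in> G" and rel: "(map g x, map g' x) \<in> listrel \<theta>'" for g g'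
    proof -
      have "(map (inv g' \<circ> g) x, x) \<in> listrel \<theta>'"
        using map_G_listrel[OF inv_G[OF g(2)] \<theta>' rel] map_inv_G(1)[OF g(2)] by simp
      then have "(map (inv g' \<circ> g) y, y) \<in> listrel \<theta>'"
        using stab[OF comp_G[OF inv_G[OF g(2)] g(1)]] by blast
      then have "(map g' (map (inv g') (map g y)), map g' y) \<in> listrel \<theta>'"
        using map_G_listrel[OF g(2) \<theta>'] by fastforce
      then show ?thesis using map_inv_G(2)[OF g(2)] by metis
    qed
    have "block_hom \<theta>' f x f' y h"
      unfolding block_hom_def
    proof (intro conjI ballI impI)
      fix z assume z: "z \<in> sat \<theta>' x"
      obtain w where w: "w \<in> blk y" and hom: "block_hom \<theta> f (rep z) f' w (k (rep z))"
        using k rep(1)[OF z] by blast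
      have "length w = length y" using w by (auto simp: blk_def listrel_iff_nth)
      then show "h z \<in> tuples A (length y)" "f z = f' (h z)" "set (h z) \<subseteq> set z"
        using hom rep(2)[OF z] unfolding block_hom_def h_def by auto
      show "h (map g z) = map g (h z)" if g: "g \<in> G" for g
        using hom rep(2)[OF z] g rep_map[OF g] unfolding block_hom_def h_def by auto
    next
      fix \<theta>'' z z'
      assume \<theta>'': "\<theta>'' \<in> E" "\<theta>'' \<subseteq> \<theta>'" and z: "z \<in> sat \<theta>' x" "z' \<in> sat \<theta>' x"
        and zz: "(z, z') \<in> listrel \<theta>''"
      have zt: "z \<in> tuples A n" "z' \<in> tuples A n" using sat_tuples z xy by auto
      \<comment> \<open>For \<theta>' itself, \<open>follow\<close> and \<open>shift\<close> compare
        images across different partial maps. Below \<theta>, both points have the same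
        representative, so a single partial map is involved.\<close>
      consider "\<theta>'' = \<theta>'" | "\<theta>'' \<subseteq> \<theta>" using cover \<theta>'' by blast
      then show "(h z, h z') \<in> listrel \<theta>''"
      proof cases
        case 1
        obtain g where g: "g \<in> G" "(z, map g x) \<in> listrel \<theta>'" "(h z, map g y) \<in> listrel \<theta>'"
          using follow z by blast
        obtain g' where g': "g' \<in> G" "(z', map g' x) \<in> listrel \<theta>'" "(h z', map g' y) \<in> listrel \<theta>'"
          using follow z by blast
        have "(map g x, map g' x) \<in> listrel \<theta>'"
          using listrel_E(2,3)[OF \<theta>'] g g' zz 1 by blast
        then show ?thesis
          using shift[OF g(1) g'(1)] listrel_E(2,3)[OF \<theta>'] g g' 1 by blast
      next
        case 2
        then have "(z, z') \<in> listrel \<theta>" using zz listrel_mono by blast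
        then have same: "rep z = rep z'" using rep_rel zt by blast
        obtain w where "block_hom \<theta> f (rep z) f' w (k (rep z))" using k rep(1)[OF z(1)] by blast
        then show ?thesis
          using 2 \<theta>''(1) zz rep(2)[OF z(1)] rep(2)[OF z(2)] same
          unfolding block_hom_def h_def by auto
      qed
    next
      obtain g where g: "g \<in> G" "(x, map g x) \<in> listrel \<theta>'" "(h x, map g y) \<in> listrel \<theta>'"
        using follow[OF sat_self[OF xy(1) \<theta>']] by blast
      have "(map g y, map id y) \<in> listrel \<theta>'"
        using shift[OF g(1) id_G] listrel_E(2)[OF \<theta>' g(2)] by simp
      then show "(h x, y) \<in> listrel \<theta>'" using g(3) listrel_E(3)[OF \<theta>'] by simp
    qed
    then show ?thesis by blast
  qed
  then show ?thesis using T'(1) unfolding classifies_def by blast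
qed

lemma finite_E: "finite E"
proof (rule finite_subset)
  show "E \<subseteq> Pow (A \<times> A)" using equiv_E equiv_type by blast
qed (use finite_A in simp)

section \<open>Induction along the chain and finiteness\<close>

text \<open>A maximal member strictly below \<theta> is its predecessor: comparability turns
  maximality into the covering hypothesis of \<open>classifies_step\<close>.\<close>

lemma classifies_exists: "\<theta> \<in> E \<Longrightarrow> \<exists>T. classifies T \<theta>"
proof (induction "card \<theta>" arbitrary: \<theta> rule: less_induct)
  case less
  have fin: "finite \<theta>"
    using finite_subset[OF equiv_type[OF equiv_E[OF less.prems]]] finite_A by simp
  show ?case
  proof (cases "\<theta> = Id_on A")
    case True
    then show ?thesis using classifies_Id by simp
  next
    case False
    define P where "P = {\<theta>'\<in>E. \<theta>' \<subset> \<theta>}"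
    have "Id_on A \<subseteq> \<theta>"
      using equiv_E[OF less.prems] by (auto elim!: equivE dest: refl_onD)
    then have "P \<noteq> {}" "finite P" using Id_in False finite_E by (auto simp: P_def)
    then obtain \<theta>' where \<theta>': "\<theta>' \<in> P" "\<And>\<theta>''. \<theta>'' \<in> P \<Longrightarrow> \<theta>' \<subseteq> \<theta>'' \<Longrightarrow> \<theta>' = \<theta>''"
      using finite_has_maximal[of P] by blast
    have mem: "\<theta>' \<in> E" "\<theta>' \<subset> \<theta>" using \<theta>' by (auto simp: P_def)
    obtain T where "classifies T \<theta>'"
      using less.hyps[OF psubset_card_mono[OF fin mem(2)] mem(1)] by blast
    then show ?thesis
    proof (rule classifies_step)
      show "\<theta>'' = \<theta> \<or> \<theta>'' \<subseteq> \<theta>'" if "\<theta>'' \<in> E" "\<theta>'' \<subseteq> \<theta>" for \<theta>''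
        using that \<theta>'(2)[of \<theta>''] chain[OF that(1) mem(1)] by (auto simp: P_def)
    qed (use mem less.prems in auto)
  qed
qed

text \<open>Modulo the full relation the partial homomorphism is total, and its coordinates preserve
  the chain, its automorphisms and all subsets. Equal types therefore give equivalence modulo every
  clone containing these polymorphisms.\<close>

lemma finite_classes:
  assumes C: "clone A C"
    and sup: "Pol A (binary_relation ` E \<union> graph_relation A ` G \<union> unary_relation ` Pow A) \<subseteq> C"
    and ne: "A \<noteq> {}"
  shows "finite (operations A // clone_equiv A C)"
proof -
  obtain T where T: "classifies T (A \<times> A)" using classifies_exists[OF total_in] by blast
  obtain a0 where a0: "a0 \<in> A" using ne by blast
  \<comment> \<open>A power is a single block of the full relation, so any base point will do; a
    constant tuple is available in every arity.\<close>
  define S where "S F = T (fst F, snd F, replicate (fst F) a0)" for F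
  have pt: "(n, f, replicate n a0) \<in> pointed" if "(n, f) \<in> operations A" for n f
    using that a0 by (auto simp: pointed_def tuples_iff)
  have le: "clone_le A C F F'"
    if F: "F \<in> operations A" and F': "F' \<in> operations A" and eq: "S F = S F'" for F F'
  proof -
    obtain n f where Fe: "F = (n, f)" by (cases F)
    obtain m f' where Fe': "F' = (m, f')" by (cases F')
    obtain h where h: "block_hom (A \<times> A) f (replicate n a0) f' (replicate m a0) h"
      using T pt[OF F[unfolded Fe]] pt[OF F'[unfolded Fe']] eq
      unfolding classifies_def S_def Fe Fe' fst_conv snd_conv by blast
    have sat: "sat (A \<times> A) (replicate n a0) = tuples A n"
      using id_G a0 by (auto simp: sat_def tuples_iff listrel_iff_nth subset_iff
          intro!: bexI[of _ id])
    have ht: "h z \<in> tuples A m" "f z = f' (h z)" "set (h z) \<subseteq> set z" if "z \<in> tuples A n" for z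
      using h that unfolding block_hom_def sat by auto
    have hg: "h (map g z) = map g (h z)" if "g \<in> G" "z \<in> tuples A n" for g z
      using h that unfolding block_hom_def sat by auto
    have hr: "(h z, h z') \<in> listrel \<theta>"
      if "\<theta> \<in> E" "z \<in> tuples A n" "z' \<in> tuples A n" "(z, z') \<in> listrel \<theta>" for \<theta> z z'
      using h that equiv_type[OF equiv_E[OF that(1)]] unfolding block_hom_def sat by simp
    show ?thesis
      unfolding Fe Fe'
    proof (rule clone_leI[where H = h])
      fix i assume i: "i < m"
      let ?k = "\<lambda>xs\<in>tuples A n. h xs ! i"
      have k: "?k \<in> tuples A n \<rightarrow>\<^sub>E A"
        using ht(1) i by (fastforce simp: tuples_iff)
      have pres: "preserves (n, ?k) R"
        if "R \<in> binary_relation ` E \<union> graph_relation A ` G \<union> unary_relation ` Pow A" for R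
        using that
      proof (elim UnE imageE)
        fix \<theta> assume R: "R = binary_relation \<theta>" and \<theta>: "\<theta> \<in> E"
        have "(?k xs, ?k ys) \<in> \<theta>" if "length xs = n" "(xs, ys) \<in> listrel \<theta>" for xs ys
        proof -
          have "xs \<in> tuples A n" "ys \<in> tuples A n"
            using that listrel_tuples[OF equiv_type[OF equiv_E[OF \<theta>]]] by blast+
          then show ?thesis
            using hr[OF \<theta> _ _ that(2)] ht(1) i by (auto simp: listrel_iff_nth tuples_iff)
        qed
        then show ?thesis unfolding R preserves_binary_iff by blast
      next
        fix g assume R: "R = graph_relation A g" and g: "g \<in> G"
        show ?thesis
          unfolding R preserves_graph_iff[OF k]
        proof
          fix xs assume xs: "xs \<in> tuples A n"
          then have "length (h xs) = m" "map g xs \<in> tuples A n"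
            using ht(1)[OF xs] map_G_tuples[OF g] by (simp_all add: tuples_iff[of "h xs"])
          then show "?k (map g xs) = g (?k xs)" using hg[OF g xs] xs i by simp
        qed
      next
        fix B assume R: "R = unary_relation B" and B: "B \<in> Pow A"
        show ?thesis
          unfolding R preserves_unary_iff
        proof
          fix xs assume xs: "xs \<in> tuples B n"
          then have xs': "xs \<in> tuples A n" using B by (auto simp: tuples_iff)
          \<comment> \<open>The clause \<open>set (h z) \<subseteq> set z\<close> of
            \<open>block_hom\<close> makes each coordinate pick one of its arguments, so every
            subset is preserved.\<close>
          have "h xs ! i \<in> set (h xs)" using ht(1)[OF xs'] i by (simp add: tuples_iff)
          then show "?k xs \<in> B" using ht(3)[OF xs'] xs xs' by (auto simp: tuples_iff)
        qed
      qed
      have op: "(n, ?k) \<in> operations A" using k F by (auto simp: operations_def Fe)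
      show "(n, ?k) \<in> C"
        by (rule subsetD[OF sup], unfold Pol_def) (intro CollectI conjI ballI op pres)
    qed (use F Fe ht in auto)
  qed
  have fin: "finite (S ` operations A)"
  proof (rule finite_subset)
    show "S ` operations A \<subseteq> T ` pointed" using pt by (auto simp: S_def)
  qed (use T in \<open>simp add: classifies_def\<close>)
  define cls where "cls F = clone_equiv A C `` {F}" for F
  have cls_eq: "cls F = cls F'" if "F \<in> operations A" "F' \<in> operations A" "S F = S F'" for F F'
    unfolding cls_def
    by (rule equiv_class_eq[OF equiv_clone_equiv[OF C]])
      (use le that in \<open>simp add: clone_equiv_def\<close>)
  \<comment> \<open>\<open>inv_into\<close> selects one operation per value of \<open>S\<close>,
    which indexes the classes by a finite set.\<close>
  have "cls F = cls (inv_into (operations A) S (S F))" if "F \<in> operations A" for F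
    using that by (intro cls_eq) (simp_all add: inv_into_into f_inv_into_f)
  then have "cls ` operations A = (\<lambda>s. cls (inv_into (operations A) S s)) ` (S ` operations A)"
    unfolding image_image by (rule image_cong[OF refl])
  then have "finite (cls ` operations A)" using fin by simp
  moreover have "operations A // clone_equiv A C = cls ` operations A"
    by (auto simp: quotient_def cls_def)
  ultimately show ?thesis by simp
qed

end

section \<open>The characterisation\<close>

lemma equiv_image_permutes:
  assumes "equiv A \<theta>" "\<gamma> permutes A"
  shows "equiv A (map_prod \<gamma> \<gamma> ` \<theta>)"
proof (rule equivI)
  have sub: "\<theta> \<subseteq> A \<times> A" using assms(1) by (rule equiv_type)
  show "map_prod \<gamma> \<gamma> ` \<theta> \<subseteq> A \<times> A"
    using sub permutes_in_image[OF assms(2)] by fastforce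
  show "refl_on A (map_prod \<gamma> \<gamma> ` \<theta>)"
  proof (rule refl_onI)
    fix a assume "a \<in> A"
    then have "(inv \<gamma> a, inv \<gamma> a) \<in> \<theta>"
      using assms permutes_in_image[OF permutes_inv[OF assms(2)]]
      by (auto elim!: equivE dest: refl_onD)
    then show "(a, a) \<in> map_prod \<gamma> \<gamma> ` \<theta>"
      using map_prod_imageI[of "inv \<gamma> a" "inv \<gamma> a" \<theta> \<gamma> \<gamma>] permutes_inverses(1)[OF assms(2)] by simp
  qed
  show "sym (map_prod \<gamma> \<gamma> ` \<theta>)"
    using equivE[OF assms(1)] by (intro symI) (auto dest: symD)
  show "trans (map_prod \<gamma> \<gamma> ` \<theta>)"
  proof (rule transI)
    fix x y z
    assume "(x, y) \<in> map_prod \<gamma> \<gamma> ` \<theta>" "(y, z) \<in> map_prod \<gamma> \<gamma> ` \<theta>"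
    then obtain a b b' c where "(a, b) \<in> \<theta>" "(b', c) \<in> \<theta>" "\<gamma> b = \<gamma> b'" "x = \<gamma> a" "z = \<gamma> c"
      by auto
    moreover from this have "b = b'" using permutes_inj[OF assms(2)] by (auto dest: injD)
    ultimately show "(x, z) \<in> map_prod \<gamma> \<gamma> ` \<theta>"
      using map_prod_imageI[of a c \<theta> \<gamma> \<gamma>] equivE[OF assms(1)] by (metis transD)
  qed
qed

text \<open>Tuples related by the image are pulled back along \<gamma> to tuples related by
  \<theta>; there \<open>F\<close> preserves \<theta>, and commuting with \<gamma> carries the
  result forward again.\<close>

lemma preserves_image_permutation:
  assumes F: "F \<in> operations A" and \<gamma>: "preserves F (graph_relation A \<gamma>)"
    and \<theta>: "preserves F (binary_relation \<theta>)" "\<theta> \<subseteq> A \<times> A"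
  shows "preserves F (binary_relation (map_prod \<gamma> \<gamma> ` \<theta>))"
proof -
  obtain n f where Fe: "F = (n, f)" by (cases F)
  have f: "f \<in> tuples A n \<rightarrow>\<^sub>E A" using F by (simp add: Fe operations_def)
  have "(f xs, f ys) \<in> map_prod \<gamma> \<gamma> ` \<theta>"
    if len: "length xs = n" and rel: "(xs, ys) \<in> listrel (map_prod \<gamma> \<gamma> ` \<theta>)" for xs ys
  proof -
    have "\<forall>i<n. \<exists>p\<in>\<theta>. (xs ! i, ys ! i) = map_prod \<gamma> \<gamma> p"
      using rel len unfolding listrel_iff_nth image_iff by blast
    then obtain p where p: "\<And>i. i < n \<Longrightarrow> p i \<in> \<theta>"
      "\<And>i. i < n \<Longrightarrow> (xs ! i, ys ! i) = map_prod \<gamma> \<gamma> (p i)" by metis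
    define us where "us = map (\<lambda>i. fst (p i)) [0..<n]"
    define vs where "vs = map (\<lambda>i. snd (p i)) [0..<n]"
    have "length ys = n" using rel len by (auto simp: listrel_iff_nth)
    then have eqs: "xs = map \<gamma> us" "ys = map \<gamma> vs"
      using len p(2) by (auto simp: us_def vs_def map_prod_def split_beta intro!: nth_equalityI)
    have "us \<in> tuples A n" "vs \<in> tuples A n"
      using p(1) \<theta>(2) by (fastforce simp: us_def vs_def tuples_iff)+
    then have "f xs = \<gamma> (f us)" "f ys = \<gamma> (f vs)"
      using \<gamma> unfolding Fe preserves_graph_iff[OF f] eqs by auto
    moreover have "(us, vs) \<in> listrel \<theta>"
      using p(1) by (auto simp: us_def vs_def listrel_iff_nth)
    then have "(f us, f vs) \<in> \<theta>"
      using \<theta>(1) unfolding Fe preserves_binary_iff by (simp add: us_def)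
    ultimately show ?thesis by force
  qed
  then show ?thesis unfolding Fe preserves_binary_iff by blast
qed

text \<open>This turns condition (b) into an inclusion between \<theta> and its image under
  \<gamma>, the form used in both directions of the characterisation.\<close>

lemma unary_operation_in_Pol_iff:
  assumes "\<gamma> permutes A" and "\<And>\<theta>. \<theta> \<in> E \<Longrightarrow> \<theta> \<subseteq> A \<times> A"
  shows "unary_operation A \<gamma> \<in> Pol A (binary_relation ` E) \<longleftrightarrow>
    (\<forall>\<theta>\<in>E. map_prod \<gamma> \<gamma> ` \<theta> \<subseteq> \<theta>)"
proof -
  let ?f = "\<lambda>xs\<in>tuples A 1. \<gamma> (xs ! 0)"
  have "\<gamma> (xs ! 0) \<in> A" if "xs \<in> tuples A 1" for xs
  proof -
    have "xs ! 0 \<in> set xs" "set xs \<subseteq> A" using that by (simp_all add: tuples_iff)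
    then show ?thesis using permutes_in_image[OF assms(1)] by blast
  qed
  then have "unary_operation A \<gamma> \<in> operations A"
    by (simp add: unary_operation_def operations_def)
  moreover have "preserves (unary_operation A \<gamma>) (binary_relation \<theta>) \<longleftrightarrow>
      map_prod \<gamma> \<gamma> ` \<theta> \<subseteq> \<theta>" if \<theta>: "\<theta> \<in> E" for \<theta>
  proof
    assume L: "preserves (unary_operation A \<gamma>) (binary_relation \<theta>)"
    have "(\<gamma> a, \<gamma> b) \<in> \<theta>" if "(a, b) \<in> \<theta>" for a b
    proof -
      have "([a], [b]) \<in> listrel \<theta>" using that by (simp add: listrel_iff_nth)
      then have "(?f [a], ?f [b]) \<in> \<theta>"
        using L unfolding unary_operation_def preserves_binary_iff by simp
      then show ?thesis using that assms(2)[OF \<theta>] by (auto simp: tuples_iff)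
    qed
    then show "map_prod \<gamma> \<gamma> ` \<theta> \<subseteq> \<theta>" by auto
  next
    assume R: "map_prod \<gamma> \<gamma> ` \<theta> \<subseteq> \<theta>"
    have "(?f xs, ?f ys) \<in> \<theta>" if xy: "length xs = 1" "(xs, ys) \<in> listrel \<theta>" for xs ys
    proof -
      obtain a b where "xs = [a]" "ys = [b]" "(a, b) \<in> \<theta>"
        using xy by (auto simp: listrel_iff_nth length_Suc_conv Suc_length_conv)
      then show ?thesis using R assms(2)[OF \<theta>] by (auto simp: tuples_iff)
    qed
    then show "preserves (unary_operation A \<gamma>) (binary_relation \<theta>)"
      unfolding unary_operation_def preserves_binary_iff by blast
  qed
  ultimately show ?thesis by (auto simp: Pol_def)
qed

theorem theorem4p1:
  fixes A :: "'a set" and E :: "'a rel set" and \<Gamma> :: "('a \<Rightarrow> 'a) set" and \<Sigma> :: "'a set set"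
  assumes "finite A" and "A \<noteq> {}"
    and "\<And>\<theta>. \<theta> \<in> E \<Longrightarrow> equiv A \<theta>"
    and "\<And>\<gamma>. \<gamma> \<in> \<Gamma> \<Longrightarrow> \<gamma> permutes A"
    and "\<And>S. S \<in> \<Sigma> \<Longrightarrow> S \<subseteq> A \<and> S \<noteq> {}"
  shows "Pol A (binary_relation ` E \<union> graph_relation A ` \<Gamma> \<union> unary_relation ` \<Sigma>) \<in> \<FF> A
    \<longleftrightarrow> (\<forall>\<theta>\<in>E. \<forall>\<theta>'\<in>E. \<theta> \<subseteq> \<theta>' \<or> \<theta>' \<subseteq> \<theta>)
      \<and> unary_operation A ` \<Gamma> \<subseteq> Pol A (binary_relation ` E)"
    (is "?C \<in> _ \<longleftrightarrow> ?chain \<and> ?pres")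
proof -
  have type: "\<theta> \<subseteq> A \<times> A" if "\<theta> \<in> E" for \<theta> using assms(3)[OF that] by (rule equiv_type)
  have C: "clone A ?C"
  proof (rule clone_Pol)
    fix R t
    assume "R \<in> binary_relation ` E \<union> graph_relation A ` \<Gamma> \<union> unary_relation ` \<Sigma>" "t \<in> snd R"
    then show "t \<in> tuples A (fst R)"
      using type assms(4,5)
      by (fastforce simp: binary_relation_def graph_relation_def unary_relation_def tuples_iff
          permutes_in_image)
  qed
  have pres_E: "preserves F (binary_relation \<theta>)" if "F \<in> ?C" "\<theta> \<in> E" for F \<theta>
    using that by (auto simp: Pol_def)
  have pres_\<Gamma>: "preserves F (graph_relation A \<gamma>)" if "F \<in> ?C" "\<gamma> \<in> \<Gamma>" for F \<gamma>
    using that by (auto simp: Pol_def)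
  \<comment> \<open>On a finite set \<theta> and its image under an injection have equally many
    pairs, so comparability already forces equality.\<close>
  have image_eq: "map_prod \<gamma> \<gamma> ` \<theta> = \<theta>"
    if "map_prod \<gamma> \<gamma> ` \<theta> \<subseteq> \<theta> \<or> \<theta> \<subseteq> map_prod \<gamma> \<gamma> ` \<theta>" "\<gamma> \<in> \<Gamma>" "\<theta> \<in> E" for \<gamma> \<theta>
  proof -
    have fin: "finite \<theta>" using finite_subset[OF type[OF that(3)]] assms(1) by simp
    have "inj (map_prod \<gamma> \<gamma>)"
      using permutes_inj[OF assms(4)[OF that(2)]] by (simp add: prod.inj_map)
    then have "card (map_prod \<gamma> \<gamma> ` \<theta>) = card \<theta>" by (meson card_image inj_on_subset subset_UNIV)
    then show ?thesis
      using that(1) card_subset_eq[OF fin] card_subset_eq[OF finite_imageI[OF fin]] by metis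
  qed
  show ?thesis
  proof
    assume "?C \<in> \<FF> A"
    then have fin: "finite (operations A // clone_equiv A ?C)" by (simp add: finite_class_clones_def)
    have ?chain
      using infinite_classes_if_incomparable[OF C assms(3) assms(3) pres_E pres_E] fin by blast
    moreover have "unary_operation A \<gamma> \<in> Pol A (binary_relation ` E)" if \<gamma>: "\<gamma> \<in> \<Gamma>" for \<gamma>
    proof -
      have "map_prod \<gamma> \<gamma> ` \<theta> \<subseteq> \<theta>" if \<theta>: "\<theta> \<in> E" for \<theta>
      proof -
        have "preserves F (binary_relation (map_prod \<gamma> \<gamma> ` \<theta>))" if "F \<in> ?C" for F
          using preserves_image_permutation[of F A \<gamma> \<theta>] pres_E[OF that \<theta>] pres_\<Gamma>[OF that \<gamma>]
            type[OF \<theta>] that by (auto simp: Pol_def)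
        \<comment> \<open>The image is again an equivalence relation preserved by the whole clone,
          so incomparability with \<theta> would contradict \<open>fin\<close>.\<close>
        then have "map_prod \<gamma> \<gamma> ` \<theta> \<subseteq> \<theta> \<or> \<theta> \<subseteq> map_prod \<gamma> \<gamma> ` \<theta>"
          using infinite_classes_if_incomparable[OF C assms(3)[OF \<theta>]
              equiv_image_permutes[OF assms(3)[OF \<theta>] assms(4)[OF \<gamma>]] pres_E[OF _ \<theta>]] fin by blast
        then show ?thesis using image_eq[OF _ \<gamma> \<theta>] by blast
      qed
      then show ?thesis using unary_operation_in_Pol_iff[OF assms(4)[OF \<gamma>] type] by blast
    qed
    ultimately show "?chain \<and> ?pres" by blast
  next
    assume R: "?chain \<and> ?pres"
    \<comment> \<open>Adjoining bottom and top keeps the chain property and supplies the two ends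
      required by the locale.\<close>
    let ?E = "insert (Id_on A) (insert (A \<times> A) E)"
    have sub: "Id_on A \<subseteq> \<theta> \<and> \<theta> \<subseteq> A \<times> A" if "\<theta> \<in> E" for \<theta>
      using assms(3)[OF that] type[OF that] by (auto elim!: equivE dest: refl_onD)
    interpret equivalence_chain A ?E
    proof
      have "equiv A (Id_on A)" "equiv A (A \<times> A)"
        by (auto intro!: equivI refl_onI symI transI)
      then show "equiv A \<theta>" if "\<theta> \<in> ?E" for \<theta>
        using that assms(3) by (elim insertE) simp_all
      show "\<theta> \<subseteq> \<theta>' \<or> \<theta>' \<subseteq> \<theta>" if mem: "\<theta> \<in> ?E" "\<theta>' \<in> ?E" for \<theta> \<theta>'
      proof -
        have bounds: "Id_on A \<subseteq> \<theta>" "\<theta> \<subseteq> A \<times> A" if "\<theta> \<in> ?E" for \<theta>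
          using that sub by auto
        consider "\<theta> = Id_on A" | "\<theta> = A \<times> A" | "\<theta>' = Id_on A" | "\<theta>' = A \<times> A" | "\<theta> \<in> E" "\<theta>' \<in> E"
          using mem by blast
        then show ?thesis
          using bounds[OF mem(1)] bounds[OF mem(2)] R by cases simp_all
      qed
    qed (use assms(1) in auto)
    \<comment> \<open>Condition (b) gives only one implication; \<open>image_eq\<close> upgrades it
      to the equivalence that defines an automorphism.\<close>
    have "\<gamma> \<in> G" if \<gamma>: "\<gamma> \<in> \<Gamma>" for \<gamma>
    proof -
      have p: "\<gamma> permutes A" using assms(4)[OF \<gamma>] .
      have inj: "inj \<gamma>" using permutes_inj[OF p] .
      have "(\<gamma> a, \<gamma> b) \<in> \<theta> \<longleftrightarrow> (a, b) \<in> \<theta>" if "\<theta> \<in> E" for \<theta> a b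
      proof -
        have "unary_operation A \<gamma> \<in> Pol A (binary_relation ` E)" using R \<gamma> by auto
        then have "map_prod \<gamma> \<gamma> ` \<theta> \<subseteq> \<theta>"
          using that unary_operation_in_Pol_iff[OF p type] by simp
        then have "map_prod \<gamma> \<gamma> ` \<theta> = \<theta>" using image_eq[OF disjI1 \<gamma> that] by simp
        then show ?thesis
          using inj_image_mem_iff[OF prod.inj_map[OF inj inj], of "(a, b)" \<theta>] by simp
      qed
      moreover have "(\<gamma> a, \<gamma> b) \<in> Id_on A \<longleftrightarrow> (a, b) \<in> Id_on A" if "a \<in> A" for a b
        using that inj permutes_in_image[OF p] by (auto simp: Id_on_def dest: injD)
      ultimately show ?thesis using p permutes_in_image[OF p] by (simp add: G_def)
    qed
    \<comment> \<open>More relations leave fewer polymorphisms, which places the given clone above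
      the one required by \<open>finite_classes\<close>.\<close>
    then have "binary_relation ` E \<union> graph_relation A ` \<Gamma> \<union> unary_relation ` \<Sigma>
        \<subseteq> binary_relation ` ?E \<union> graph_relation A ` G \<union> unary_relation ` Pow A"
      using assms(5) by (intro Un_mono image_mono) auto
    then have "Pol A (binary_relation ` ?E \<union> graph_relation A ` G \<union> unary_relation ` Pow A) \<subseteq> ?C"
      unfolding Pol_def by (intro Collect_mono) blast
    then have "finite (operations A // clone_equiv A ?C)"
      using finite_classes[OF C] assms(2) by simp
    then show "?C \<in> \<FF> A" using C by (simp add: finite_class_clones_def)
  qed
qed

end
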